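(* Let $\mathbf{v}_1,\ldots,\mathbf{v}_r\in\mathbb{R}^n$ form an equiangular tight frame with constant $\alpha$ and signs $\sigma_{i,j}$. Then there is $C\in\mathbb{R}$ such that $$\sum_{i\in[r]\setminus\{j\}}\sigma_{i,j}\mathbf{v}_i=C\mathbf{v}_j\quad\text{for all } j\in[r].$$ In particular, when $d$ is even, all of $\mathbf{v}_1,\ldots,\mathbf{v}_r$ are eigenvectors of the tensor $$\mathcal{T}=\sum_{i=1}^r\mathbf{v}_i^{\otimes d}.$$ Furthermore, in this case, all of these vectors are robust eigenvectors of $\mathcal{T}$ if $$\frac{\frac{r}{n}\alpha^{d-2}(d-1)}{1+\alpha^{d-2}\left(\frac{r}{n}-1\right)}<1,$$ which always holds when $d$ is large enough.
   Context: $[r]=\{1,\ldots,r\}$. An equiangular set is a collection of vectors $\mathbf{v}_1,\ldots,\mathbf{v}_r\in\mathbb{R}^n$ with $r\geq n$ for which there exists $\alpha\in\mathbb{R}$ such that $|\langle\mathbf{v}_i,\mathbf{v}_j\rangle|=\alpha$ for all $i\neq j$ and $\|\mathbf{v}_i\|=1$ for all $i$. For $i\neq j$, $\sigma_{i,j}=\mathrm{sgn}(\langle\mathbf{v}_i,\mathbf{v}_j\rangle)\in\{1,-1\}$, so $\langle\mathbf{v}_i,\mathbf{v}_j\rangle=\sigma_{i,j}\alpha$. It is an equiangular tight frame (ETF) if, in addition, $\mathbf{V}\mathbf{V}^\top=\frac{r}{n}\mathbf{I}_n$, where $\mathbf{V}\in\mathbb{R}^{n\times r}$ is the matrix with columns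 $\mathbf{v}_1,\ldots,\mathbf{v}_r$ and $\mathbf{I}_n$ is the identity matrix. For a real symmetric tensor $\mathcal{T}$ of order $d$ and dimension $n$ and $\mathbf{x}\in\mathbb{R}^n$, $\mathcal{T}\cdot\mathbf{x}^{d-1}\in\mathbb{R}^n$ is the vector with $i$-th entry $\sum_{i_1,\ldots,i_{d-1}=1}^n \mathcal{T}_{i_1\cdots i_{d-1} i}\,x_{i_1}\cdots x_{i_{d-1}}$; for $\mathcal{T}=\sum_i\mathbf{v}_i^{\otimes d}$ this is $\sum_i\langle\mathbf{v}_i,\mathbf{x}\rangle^{d-1}\mathbf{v}_i$. A vector $\mathbf{v}$ is an eigenvector of $\mathcal{T}$ with eigenvalue $\mu\in\mathbb{R}$ if $\mathcal{T}\cdot\mathbf{v}^{d-1}=\mu\mathbf{v}$. The tensor power method for $\mathcal{T}$ is the iteration $\mathbf{x}_{k+1}=\mathcal{T}\cdot\mathbf{x}_k^{d-1}/\|\mathcal{T}\cdot\mathbf{x}_k^{d-1}\|$ started at an initializing vector $\mathbf{x}_0\in\mathbb{R}^n$, $\mathbf{x}_0\neq 0$. A robust eigenvector of $\mathcal{T}$ is an eigenvector $\mathbf{v}$ that is an attracting fixed point of the tensor power method: there exists $\epsilon>0$ such that the tensor power method converges to $\mathbf{v}$ for every initializing vector $\mathbf{x}_0$ in the ball $B_\epsilon(\mathbf{v})$ of radius $\epsilon$ centered at $\mathbf{v}$.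
   Formalization: The final clause, that the inequality always holds when d is large enough, is claimed only for n ≥ 2; for n = 1 and r ≥ 2 one has α = 1 and the quotient equals d − 1, so that clause fails. *)

theory Defs
  imports "HOL-Analysis.Analysis"
begin

section \<open>Equiangular tight frames\<close>

text \<open>A family of \<open>r\<close> vectors in \<open>n\<close>-dimensional Euclidean space is a function \<open>v :: 'r \<Rightarrow> real ^ 'n\<close>
  on a finite index type, with \<open>r = CARD('r)\<close> and \<open>n = CARD('n)\<close>. For \<open>r = 1\<close> there are no pairs
  \<open>i \<noteq> j\<close>, and the constant \<open>\<alpha>\<close> is unconstrained.\<close>

definition equiangular :: "('r::finite \<Rightarrow> real ^ 'n) \<Rightarrow> real \<Rightarrow> bool" where
  "equiangular v \<alpha> \<longleftrightarrow>
     CARD('r) \<ge> CARD('n) \<and>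
     (\<forall>i j. i \<noteq> j \<longrightarrow> \<bar>v i \<bullet> v j\<bar> = \<alpha>) \<and>
     (\<forall>i. norm (v i) = 1)"

definition frame_matrix :: "('r::finite \<Rightarrow> real ^ 'n) \<Rightarrow> real ^ 'r ^ 'n" where
  "frame_matrix v = (\<chi> k i. v i $ k)"

lemma column_frame_matrix: "column i (frame_matrix v) = v i"
  by (simp add: column_def frame_matrix_def)

definition equiangular_tight_frame :: "('r::finite \<Rightarrow> real ^ 'n) \<Rightarrow> real \<Rightarrow> bool" where
  "equiangular_tight_frame v \<alpha> \<longleftrightarrow>
     equiangular v \<alpha> \<and>
     frame_matrix v ** transpose (frame_matrix v)
       = (real CARD('r) / real CARD('n)) *\<^sub>R (mat 1 :: real ^ 'n ^ 'n)"

text \<open>For orthonormal bases (\<open>\<alpha> = 0\<close>) the sign is \<open>sgn 0 = 0\<close>; otherwise it is \<open>1\<close> or \<open>-1\<close>.\<close>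

definition frame_sign :: "('r \<Rightarrow> real ^ 'n) \<Rightarrow> 'r \<Rightarrow> 'r \<Rightarrow> real" where
  "frame_sign v i j = sgn (v i \<bullet> v j)"

section \<open>Tensors\<close>

text \<open>A tensor of order \<open>d\<close> and dimension \<open>n = CARD('n)\<close> is the function giving its entries,
  indexed by the lists \<open>[i\<^sub>1, \<dots>, i\<^sub>d]\<close> of length \<open>d\<close>; it is zero on all other lists.\<close>

type_synonym 'n tensor = "'n list \<Rightarrow> real"

definition tensor_power :: "nat \<Rightarrow> real ^ 'n \<Rightarrow> 'n tensor" where
  "tensor_power d v = (\<lambda>is. if length is = d then (\<Prod>k\<leftarrow>is. v $ k) else 0)"

definition frame_tensor :: "nat \<Rightarrow> ('r::finite \<Rightarrow> real ^ 'n) \<Rightarrow> 'n tensor" where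
  "frame_tensor d v = (\<lambda>is. \<Sum>i\<in>UNIV. tensor_power d (v i) is)"

text \<open>The vector \<open>T \<cdot> x\<^sup>d\<^sup>-\<^sup>1\<close> for a tensor \<open>T\<close> of order \<open>d \<ge> 1\<close>.\<close>

definition tensor_apply :: "nat \<Rightarrow> 'n tensor \<Rightarrow> real ^ 'n \<Rightarrow> real ^ 'n" where
  "tensor_apply d T x =
     (\<chi> i. \<Sum>is | length is = d - 1. T (is @ [i]) * (\<Prod>k\<leftarrow>is. x $ k))"

definition eigenvector_with :: "nat \<Rightarrow> 'n tensor \<Rightarrow> real ^ 'n \<Rightarrow> real \<Rightarrow> bool" where
  "eigenvector_with d T v \<mu> \<longleftrightarrow> v \<noteq> 0 \<and> tensor_apply d T v = \<mu> *\<^sub>R v"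

definition eigenvector :: "nat \<Rightarrow> 'n tensor \<Rightarrow> real ^ 'n \<Rightarrow> bool" where
  "eigenvector d T v \<longleftrightarrow> (\<exists>\<mu>. eigenvector_with d T v \<mu>)"

text \<open>The step below returns \<open>0\<close> when \<open>T \<cdot> x\<^sup>d\<^sup>-\<^sup>1 = 0\<close>, where the iteration is undefined. For
  \<open>d \<ge> 2\<close> all later iterates are then \<open>0\<close> as well, so a sequence that converges to a nonzero
  vector never meets this case.\<close>

definition power_step :: "nat \<Rightarrow> 'n tensor \<Rightarrow> real ^ 'n \<Rightarrow> real ^ 'n" where
  "power_step d T x = tensor_apply d T x /\<^sub>R norm (tensor_apply d T x)"

definition power_method :: "nat \<Rightarrow> 'n tensor \<Rightarrow> real ^ 'n \<Rightarrow> nat \<Rightarrow> real ^ 'n" where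
  "power_method d T x0 k = (power_step d T ^^ k) x0"

definition robust_eigenvector :: "nat \<Rightarrow> 'n tensor \<Rightarrow> real ^ 'n \<Rightarrow> bool" where
  "robust_eigenvector d T v \<longleftrightarrow>
     eigenvector d T v \<and>
     (\<exists>\<epsilon>>0. \<forall>x0\<in>ball v \<epsilon>. x0 \<noteq> 0 \<longrightarrow> power_method d T x0 \<longlonglongrightarrow> v)"

lemma sum_lists_prod:
  fixes f :: "'n::finite \<Rightarrow> real"
  shows "(\<Sum>is | length is = m. \<Prod>k\<leftarrow>is. f k) = (\<Sum>k\<in>UNIV. f k) ^ m"
proof (induction m)
  case 0
  have "{is :: 'n list. length is = 0} = {[]}" by auto
  then show ?case by simp
next
  case (Suc m)
  have eq: "{is :: 'n list. length is = Suc m} = (\<lambda>(k, is). k # is) ` (UNIV \<times> {is. length is = m})"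
    by (auto simp: length_Suc_conv image_iff)
  have inj: "inj_on (\<lambda>(k, is). k # is) (UNIV \<times> {is :: 'n list. length is = m})"
    by (auto simp: inj_on_def)
  have "(\<Sum>is | length is = Suc m. \<Prod>k\<leftarrow>is. f k)
      = (\<Sum>(k, is)\<in>UNIV \<times> {is. length is = m}. f k * (\<Prod>k\<leftarrow>is. f k))"
    unfolding eq by (subst sum.reindex[OF inj]) (auto intro!: sum.cong)
  also have "\<dots> = (\<Sum>k\<in>UNIV. f k) * (\<Sum>is | length is = m. \<Prod>k\<leftarrow>is. f k)"
    by (simp add: sum.cartesian_product[symmetric] sum_product)
  finally show ?case using Suc.IH by simp
qed

lemma tensor_apply_frame_tensor:
  fixes v :: "'r::finite \<Rightarrow> real ^ 'n"
  assumes "d \<ge> 1"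
  shows "tensor_apply d (frame_tensor d v) x = (\<Sum>i\<in>UNIV. ((v i \<bullet> x) ^ (d - 1)) *\<^sub>R v i)"
proof -
  have prod: "(\<Prod>k\<leftarrow>is. a $ k) * (\<Prod>k\<leftarrow>is. x $ k) = (\<Prod>k\<leftarrow>is. a $ k * x $ k)"
    for a :: "real ^ 'n" and "is"
    by (induction "is") (simp_all add: algebra_simps)
  have "tensor_apply d (frame_tensor d v) x $ l
      = (\<Sum>i\<in>UNIV. ((v i \<bullet> x) ^ (d - 1)) *\<^sub>R v i) $ l" for l
  proof -
    have "tensor_apply d (frame_tensor d v) x $ l
        = (\<Sum>is | length is = d - 1. \<Sum>i\<in>UNIV. v i $ l * (\<Prod>k\<leftarrow>is. v i $ k * x $ k))"
      using assms unfolding prod[symmetric]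
      by (auto simp: tensor_apply_def frame_tensor_def tensor_power_def sum_distrib_left
          mult_ac intro!: sum.cong)
    also have "\<dots> = (\<Sum>i\<in>UNIV. v i $ l * (\<Sum>is | length is = d - 1. \<Prod>k\<leftarrow>is. v i $ k * x $ k))"
      by (subst sum.swap) (simp add: sum_distrib_left)
    also have "\<dots> = (\<Sum>i\<in>UNIV. ((v i \<bullet> x) ^ (d - 1)) *\<^sub>R v i) $ l"
      by (simp add: sum_lists_prod inner_vec_def mult.commute)
    finally show ?thesis .
  qed
  then show ?thesis by (simp add: vec_eq_iff)
qed

end

theory Submission
  imports Defs
begin

text \<open>Tightness says \<open>\<Sum>\<^sub>i \<langle>v\<^sub>i, x\<rangle> v\<^sub>i = (r/n) x\<close>. Off the diagonal \<open>\<langle>v\<^sub>i, v\<^sub>j\<rangle>\<^sup>2 = \<alpha>\<^sup>2\<close>, so for even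
  \<open>d\<close> the weights \<open>\<langle>v\<^sub>i, v\<^sub>j\<rangle>\<^sup>d\<^sup>-\<^sup>2\<close> equal \<open>\<alpha>\<^sup>d\<^sup>-\<^sup>2\<close> for \<open>i \<noteq> j\<close> and \<open>1\<close> for \<open>i = j\<close>, and the sum
  \<open>\<Sum>\<^sub>i \<langle>v\<^sub>i, v\<^sub>j\<rangle>\<^sup>d\<^sup>-\<^sup>2 \<langle>v\<^sub>i, x\<rangle> v\<^sub>i\<close> is \<open>(1 - \<alpha>\<^sup>d\<^sup>-\<^sup>2) \<langle>v\<^sub>j, x\<rangle> v\<^sub>j + \<alpha>\<^sup>d\<^sup>-\<^sup>2 (r/n) x\<close>. At
  \<open>x = v\<^sub>j\<close> this gives the eigenvalue \<open>\<mu> = 1 + \<alpha>\<^sup>d\<^sup>-\<^sup>2 (r/n - 1)\<close>; for general \<open>x\<close> it shows that the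
  derivative of the power step at \<open>v\<^sub>j\<close> is \<open>(r/n) \<alpha>\<^sup>d\<^sup>-\<^sup>2 (d - 1) / \<mu>\<close> times the orthogonal projection
  onto the complement of \<open>v\<^sub>j\<close>, a contraction exactly under the stated condition.\<close>

section \<open>Differentiable maps: attracting fixed points and normalization\<close>

text \<open>Close to \<open>p\<close> the linearization error is at most (1 - c)/2 times the
  distance to \<open>p\<close>. Together with the factor c of \<open>A\<close>, this makes
  \<open>F\<close> shrink that distance by q = (1 + c)/2 < 1, so the iterates converge
  geometrically.\<close>

lemma attracting_fixed_point:
  fixes F :: "'a::real_normed_vector \<Rightarrow> 'a"
  assumes der: "(F has_derivative A) (at p)" and Fp: "F p = p"
    and A: "\<And>h. norm (A h) \<le> c * norm h" and "0 \<le> c" "c < 1"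
  shows "\<exists>\<epsilon>>0. \<forall>x\<in>ball p \<epsilon>. (\<lambda>k. (F ^^ k) x) \<longlonglongrightarrow> p"
proof -
  define q where "q = (1 + c) / 2"
  have q: "0 \<le> q" "q < 1" "(1 - c) / 2 + c = q" "(1 - c) / 2 > 0"
    using \<open>0 \<le> c\<close> \<open>c < 1\<close> by (auto simp: q_def field_simps)
  obtain \<epsilon> where "\<epsilon> > 0"
    and \<epsilon>: "\<And>y. norm (y - p) < \<epsilon> \<Longrightarrow> norm (F y - F p - A (y - p)) \<le> (1 - c) / 2 * norm (y - p)"
    using der q(4) unfolding has_derivative_at_alt by blast
  have step: "norm (F y - p) \<le> q * norm (y - p)" if "norm (y - p) < \<epsilon>" for y
  proof -
    have "norm (F y - p) \<le> norm (F y - F p - A (y - p)) + norm (A (y - p))"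
      using norm_triangle_ineq[of "F y - F p - A (y - p)" "A (y - p)"] by (simp add: Fp)
    also have "\<dots> \<le> (1 - c) / 2 * norm (y - p) + c * norm (y - p)"
      using \<epsilon>[OF that] A by (intro add_mono)
    also have "\<dots> = q * norm (y - p)"
      by (simp only: distrib_right[symmetric] q(3))
    finally show ?thesis .
  qed
  have "(\<lambda>k. (F ^^ k) x) \<longlonglongrightarrow> p" if "x \<in> ball p \<epsilon>" for x
  proof -
    have x: "norm (x - p) < \<epsilon>"
      using that by (simp add: dist_norm norm_minus_commute)
    have bound: "norm ((F ^^ k) x - p) \<le> q ^ k * norm (x - p)" for k
    proof (induction k)
      case (Suc k)
      \<comment> \<open>This keeps the k-th iterate inside the ball on which \<open>step\<close>
        applies.\<close>
      have "q ^ k * norm (x - p) \<le> 1 * norm (x - p)"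
        using q by (intro mult_right_mono) (auto intro: power_le_one)
      then have "norm (F ((F ^^ k) x) - p) \<le> q * norm ((F ^^ k) x - p)"
        using Suc.IH x by (intro step) simp
      also have "\<dots> \<le> q * (q ^ k * norm (x - p))"
        using Suc.IH q by (intro mult_left_mono)
      finally show ?case by (simp add: mult.assoc)
    qed simp
    have "(\<lambda>k. q ^ k * norm (x - p)) \<longlonglongrightarrow> 0"
      using q by (intro tendsto_mult_left_zero LIMSEQ_power_zero) simp
    then have "(\<lambda>k. (F ^^ k) x - p) \<longlonglongrightarrow> 0"
      by (rule Lim_null_comparison[rotated]) (simp add: bound)
    then show ?thesis by (simp add: LIM_zero_iff)
  qed
  with \<open>\<epsilon> > 0\<close> show ?thesis by blast
qed

text \<open>To first order the component of \<open>G'\<close> along \<open>u\<close> only changes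
  the norm, so normalization removes it and divides what remains by \<mu>.\<close>

lemma has_derivative_normalize:
  fixes G :: "'a::real_normed_vector \<Rightarrow> 'b::real_inner"
  assumes "(G has_derivative G') (at p)" and Gp: "G p = \<mu> *\<^sub>R u" and "\<mu> > 0" "norm u = 1"
  shows "((\<lambda>x. G x /\<^sub>R norm (G x)) has_derivative (\<lambda>h. (G' h - (u \<bullet> G' h) *\<^sub>R u) /\<^sub>R \<mu>)) (at p)"
proof -
  have nz: "G p \<noteq> 0" and nG: "norm (G p) = \<mu>" and sg: "sgn (G p) = u"
    using assms by (auto simp: sgn_div_norm)
  have "((\<lambda>x. norm (G x)) has_derivative (\<lambda>h. u \<bullet> G' h)) (at p)"
    using has_derivative_compose[OF assms(1) has_derivative_norm[OF nz]] sg
    by (simp add: inner_commute)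
  from Deriv.has_derivative_inverse[OF _ this] have "((\<lambda>x. inverse (norm (G x))) has_derivative
      (\<lambda>h. - (inverse \<mu> * (u \<bullet> G' h) * inverse \<mu>))) (at p)"
    using \<open>\<mu> > 0\<close> by (simp add: nG)
  from has_derivative_scaleR[OF this assms(1)] have "((\<lambda>x. G x /\<^sub>R norm (G x)) has_derivative
      (\<lambda>h. inverse \<mu> *\<^sub>R G' h + (- (inverse \<mu> * (u \<bullet> G' h) * inverse \<mu>)) *\<^sub>R \<mu> *\<^sub>R u)) (at p)"
    unfolding nG unfolding Gp .
  moreover have "inverse \<mu> *\<^sub>R G' h + (- (inverse \<mu> * (u \<bullet> G' h) * inverse \<mu>)) *\<^sub>R \<mu> *\<^sub>R u
      = (G' h - (u \<bullet> G' h) *\<^sub>R u) /\<^sub>R \<mu>" for h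
    using \<open>\<mu> > 0\<close> by (simp add: scaleR_diff_right)
  ultimately show ?thesis by simp
qed

lemma norm_orthogonal_part_le:
  fixes u h :: "'a::real_inner"
  assumes "norm u = 1"
  shows "norm (h - (u \<bullet> h) *\<^sub>R u) \<le> norm h"
proof -
  have "u \<bullet> u = 1"
    using assms by (simp add: norm_eq_1)
  then have "(norm (h - (u \<bullet> h) *\<^sub>R u))\<^sup>2 = (norm h)\<^sup>2 - (u \<bullet> h)\<^sup>2"
    unfolding power2_norm_eq_inner
    by (simp add: inner_diff_left inner_diff_right inner_commute power2_eq_square)
  also have "\<dots> \<le> (norm h)\<^sup>2" by simp
  finally show ?thesis by (rule power2_le_imp_le) simp
qed

section \<open>Linear identities for equiangular tight frames\<close>

lemma tight_frame_expansion:
  fixes v :: "'r::finite \<Rightarrow> real ^ 'n"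
  assumes "frame_matrix v ** transpose (frame_matrix v) = \<rho> *\<^sub>R (mat 1 :: real ^ 'n ^ 'n)"
  shows "(\<Sum>i\<in>UNIV. (v i \<bullet> x) *\<^sub>R v i) = \<rho> *\<^sub>R x"
proof -
  have "(\<Sum>i\<in>UNIV. (v i \<bullet> x) *\<^sub>R v i) = frame_matrix v *v (transpose (frame_matrix v) *v x)"
    by (simp add: vec_eq_iff matrix_vector_mult_def transpose_def frame_matrix_def inner_vec_def
        mult.commute)
  also have "\<dots> = (\<rho> *\<^sub>R (mat 1 :: real ^ 'n ^ 'n)) *v x"
    by (simp only: matrix_vector_mul_assoc assms)
  also have "\<dots> = \<rho> *\<^sub>R x"
    by (simp add: scaleR_matrix_vector_assoc[symmetric])
  finally show ?thesis .
qed

text \<open>\<open>\<rho>\<close> is the frame bound r/n. The sign of \<alpha> is not fixed: for r =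
  1 it is an arbitrary real.\<close>

locale etf =
  fixes v :: "'r::finite \<Rightarrow> real ^ 'n" and \<alpha> \<rho> :: real
  assumes etf: "equiangular_tight_frame v \<alpha>"
  defines "\<rho> \<equiv> real CARD('r) / real CARD('n)"
begin

lemma norm_v: "norm (v i) = 1"
  using etf by (simp add: equiangular_tight_frame_def equiangular_def)

lemma inner_v_self: "v i \<bullet> v i = 1"
  using norm_v by (simp add: norm_eq_1)

lemma abs_inner_v: "i \<noteq> j \<Longrightarrow> \<bar>v i \<bullet> v j\<bar> = \<alpha>"
  using etf by (simp add: equiangular_tight_frame_def equiangular_def)

lemma \<rho>_ge_1: "\<rho> \<ge> 1"
  using etf by (simp add: equiangular_tight_frame_def equiangular_def \<rho>_def)

lemma expansion: "(\<Sum>i\<in>UNIV. (v i \<bullet> x) *\<^sub>R v i) = \<rho> *\<^sub>R x"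
  using etf by (intro tight_frame_expansion) (simp add: equiangular_tight_frame_def \<rho>_def)

text \<open>Each weight is the constant \<open>a\<close>, which tightness sums to
  \<open>a * \<rho>\<close> times \<open>x\<close>, plus an excess 1 - a present only at i =
  j.\<close>

lemma weighted_expansion:
  assumes "\<And>i. i \<noteq> j \<Longrightarrow> w i = a" "w j = 1"
  shows "(\<Sum>i\<in>UNIV. (w i * (v i \<bullet> x)) *\<^sub>R v i) = ((1 - a) * (v j \<bullet> x)) *\<^sub>R v j + (a * \<rho>) *\<^sub>R x"
proof -
  have "(w i * (v i \<bullet> x)) *\<^sub>R v i
      = (if i = j then ((1 - a) * (v j \<bullet> x)) *\<^sub>R v j else 0) + a *\<^sub>R (v i \<bullet> x) *\<^sub>R v i" for i
    using assms by (simp add: algebra_simps)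
  then have "(\<Sum>i\<in>UNIV. (w i * (v i \<bullet> x)) *\<^sub>R v i)
      = ((1 - a) * (v j \<bullet> x)) *\<^sub>R v j + a *\<^sub>R (\<Sum>i\<in>UNIV. (v i \<bullet> x) *\<^sub>R v i)"
    by (simp add: sum.distrib scaleR_sum_right)
  then show ?thesis by (simp add: expansion)
qed

lemma inner_v_power:
  assumes "even m" "i \<noteq> j"
  shows "(v i \<bullet> v j) ^ m = \<alpha> ^ m"
  using abs_inner_v[OF assms(2)] power_even_abs[OF assms(1), of "v i \<bullet> v j"] by simp

text \<open>For \<open>\<alpha> = 0\<close> both sides are \<open>0\<close>, since \<open>sgn 0 = 0\<close> and \<open>x / 0 = 0\<close>.\<close>

lemma signed_sum_proportional:
  "(\<Sum>i\<in>UNIV - {j}. frame_sign v i j *\<^sub>R v i) = ((\<rho> - 1) / \<alpha>) *\<^sub>R v j"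
\<comment> \<open>For r = 1 the sum is empty; n \<le> r then forces n = 1, so the coefficient
  vanishes as well.\<close>
proof (cases "UNIV = {j}")
  case True
  then have "CARD('r) = 1" by (metis card_1_singleton_iff One_nat_def)
  moreover have "CARD('r) \<ge> CARD('n)"
    using etf by (simp add: equiangular_tight_frame_def equiangular_def)
  ultimately have "CARD('n) = 1"
    using zero_less_card_finite[where 'a = 'n] by linarith
  with \<open>CARD('r) = 1\<close> have "\<rho> = 1" by (simp add: \<rho>_def)
  with True show ?thesis by simp
next
  case False
  have *: "frame_sign v i j = (v i \<bullet> v j) / \<alpha>" if "i \<noteq> j" for i
    using abs_inner_v[OF that] by (auto simp: frame_sign_def sgn_real_def field_simps)
  have "(\<Sum>i\<in>UNIV - {j}. frame_sign v i j *\<^sub>R v i)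
      = (1 / \<alpha>) *\<^sub>R (\<Sum>i\<in>UNIV - {j}. (v i \<bullet> v j) *\<^sub>R v i)"
    unfolding scaleR_sum_right by (intro sum.cong) (auto simp: *)
  \<comment> \<open>The expansion of \<open>v j\<close> loses its diagonal term, which is
    \<open>v j\<close> itself.\<close>
  also have "(\<Sum>i\<in>UNIV - {j}. (v i \<bullet> v j) *\<^sub>R v i) = (\<rho> - 1) *\<^sub>R v j"
    using expansion[of "v j"] by (simp add: sum_diff1 inner_v_self algebra_simps)
  finally show ?thesis by simp
qed

section \<open>The frame vectors as eigenvectors and as attracting fixed points\<close>

lemma tensor_apply_v:
  assumes "even d" "d > 0"
  shows "tensor_apply d (frame_tensor d v) (v j) = (1 + \<alpha> ^ (d - 2) * (\<rho> - 1)) *\<^sub>R v j"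
proof -
  \<comment> \<open>An even positive \<open>d\<close> is at least 2, so the subtraction is exact.
    One inner product is split off, leaving an even power as weight.\<close>
  from assms have d: "d - 1 = Suc (d - 2)" "even (d - 2)" by presburger+
  have "tensor_apply d (frame_tensor d v) (v j)
      = (\<Sum>i\<in>UNIV. ((v i \<bullet> v j) ^ (d - 2) * (v i \<bullet> v j)) *\<^sub>R v i)"
    using assms by (simp add: tensor_apply_frame_tensor d(1) mult.commute del: One_nat_def)
  also have "\<dots> = (1 + \<alpha> ^ (d - 2) * (\<rho> - 1)) *\<^sub>R v j"
    by (subst weighted_expansion[where j = j and a = "\<alpha> ^ (d - 2)"])
      (simp_all add: inner_v_power[OF d(2)] inner_v_self algebra_simps)
  finally show ?thesis .
qed

lemma eigenvector_v:
  assumes "even d" "d > 0"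
  shows "eigenvector d (frame_tensor d v) (v j)"
  using tensor_apply_v[OF assms, of j] norm_v[of j]
  by (auto simp: eigenvector_def eigenvector_with_def)

text \<open>The power rule leaves the even power d - 2 of the inner products with \<open>v j\<close>
  as weights, so \<open>weighted_expansion\<close> applies with x = h.\<close>

lemma tensor_apply_has_derivative:
  assumes "even d" "d > 0"
  shows "(tensor_apply d (frame_tensor d v) has_derivative
    (\<lambda>h. (real d - 1) *\<^sub>R (((1 - \<alpha> ^ (d - 2)) * (v j \<bullet> h)) *\<^sub>R v j + (\<alpha> ^ (d - 2) * \<rho>) *\<^sub>R h)))
    (at (v j))"
proof -
  from assms have d: "d - 1 = Suc (d - 2)" "even (d - 2)" by presburger+
  from assms have rd: "real (d - 1) = real d - 1" by (simp add: of_nat_diff)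
  have T: "tensor_apply d (frame_tensor d v) = (\<lambda>x. \<Sum>i\<in>UNIV. ((v i \<bullet> x) ^ (d - 1)) *\<^sub>R v i)"
    using assms by (intro ext tensor_apply_frame_tensor) simp
  have "((\<lambda>x. \<Sum>i\<in>UNIV. ((v i \<bullet> x) ^ (d - 1)) *\<^sub>R v i) has_derivative
      (\<lambda>h. \<Sum>i\<in>UNIV. (real (d - 1) * (v i \<bullet> h) * (v i \<bullet> v j) ^ (d - 1 - 1)) *\<^sub>R v i)) (at (v j))"
    by (auto intro!: derivative_eq_intros sum.cong simp: mult_ac)
  moreover have "(\<Sum>i\<in>UNIV. (real (d - 1) * (v i \<bullet> h) * (v i \<bullet> v j) ^ (d - 1 - 1)) *\<^sub>R v i)
      = (real d - 1) *\<^sub>R (((1 - \<alpha> ^ (d - 2)) * (v j \<bullet> h)) *\<^sub>R v j + (\<alpha> ^ (d - 2) * \<rho>) *\<^sub>R h)" for h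
  proof -
    have "(\<Sum>i\<in>UNIV. (real (d - 1) * (v i \<bullet> h) * (v i \<bullet> v j) ^ (d - 1 - 1)) *\<^sub>R v i)
        = (real d - 1) *\<^sub>R (\<Sum>i\<in>UNIV. ((v i \<bullet> v j) ^ (d - 2) * (v i \<bullet> h)) *\<^sub>R v i)"
      unfolding scaleR_sum_right rd by (intro sum.cong) (simp_all add: d(1) mult_ac del: One_nat_def)
    also have "(\<Sum>i\<in>UNIV. ((v i \<bullet> v j) ^ (d - 2) * (v i \<bullet> h)) *\<^sub>R v i)
        = ((1 - \<alpha> ^ (d - 2)) * (v j \<bullet> h)) *\<^sub>R v j + (\<alpha> ^ (d - 2) * \<rho>) *\<^sub>R h"
      by (rule weighted_expansion) (simp_all add: inner_v_power[OF d(2)] inner_v_self)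
    finally show ?thesis .
  qed
  ultimately show ?thesis unfolding T by simp
qed

lemma robust_eigenvector_v:
  assumes "even d" "d > 0"
    and less: "\<rho> * \<alpha> ^ (d - 2) * (real d - 1) / (1 + \<alpha> ^ (d - 2) * (\<rho> - 1)) < 1"
  shows "robust_eigenvector d (frame_tensor d v) (v j)"
proof -
  define T where "T = frame_tensor d v"
  define a where "a = \<alpha> ^ (d - 2)"
  define \<mu> where "\<mu> = 1 + a * (\<rho> - 1)"
  define c where "c = \<rho> * a * (real d - 1) / \<mu>"
  define G' where "G' = (\<lambda>h. (real d - 1) *\<^sub>R (((1 - a) * (v j \<bullet> h)) *\<^sub>R v j + (a * \<rho>) *\<^sub>R h))"
  \<comment> \<open>Evenness of the exponent gives this for either sign of \<alpha>.\<close>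
  have "a \<ge> 0" using \<open>even d\<close> by (simp add: a_def zero_le_even_power)
  then have "\<mu> > 0" using \<rho>_ge_1 by (simp add: \<mu>_def add_pos_nonneg)
  have "0 \<le> c"
    using \<open>a \<ge> 0\<close> \<open>\<mu> > 0\<close> \<rho>_ge_1 \<open>d > 0\<close> by (simp add: c_def)
  have "c < 1" using less by (simp add: c_def \<mu>_def a_def)
  have Tv: "tensor_apply d T (v j) = \<mu> *\<^sub>R v j"
    using tensor_apply_v[OF assms(1,2)] by (simp add: T_def \<mu>_def a_def)
  have "(power_step d T has_derivative (\<lambda>h. (G' h - (v j \<bullet> G' h) *\<^sub>R v j) /\<^sub>R \<mu>)) (at (v j))"
    unfolding power_step_def
    using tensor_apply_has_derivative[OF assms(1,2)] Tv \<open>\<mu> > 0\<close> norm_v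
    by (intro has_derivative_normalize) (simp_all add: T_def G'_def a_def)
  \<comment> \<open>The projection kills the \<open>v j\<close> term of \<open>G'\<close>; only the
    multiple of \<open>h\<close> survives.\<close>
  moreover have "(G' h - (v j \<bullet> G' h) *\<^sub>R v j) /\<^sub>R \<mu> = c *\<^sub>R (h - (v j \<bullet> h) *\<^sub>R v j)" for h
    by (simp add: G'_def c_def inner_add_right inner_v_self algebra_simps divide_inverse)
  ultimately have "(power_step d T has_derivative (\<lambda>h. c *\<^sub>R (h - (v j \<bullet> h) *\<^sub>R v j))) (at (v j))"
    by simp
  moreover have "power_step d T (v j) = v j"
    using \<open>\<mu> > 0\<close> by (simp add: power_step_def Tv norm_v)
  moreover have "norm (c *\<^sub>R (h - (v j \<bullet> h) *\<^sub>R v j)) \<le> c * norm h" for h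
    using norm_orthogonal_part_le[OF norm_v] \<open>0 \<le> c\<close> by (simp add: mult_left_mono)
  ultimately obtain \<epsilon> where "\<epsilon> > 0" "\<forall>x\<in>ball (v j) \<epsilon>. (\<lambda>k. (power_step d T ^^ k) x) \<longlonglongrightarrow> v j"
    using attracting_fixed_point \<open>0 \<le> c\<close> \<open>c < 1\<close> by blast
  then show ?thesis
    using eigenvector_v[OF assms(1,2)] unfolding robust_eigenvector_def power_method_def T_def
    by blast
qed

section \<open>The robustness condition for large \<open>d\<close>\<close>

text \<open>Otherwise the squared inner products with a fixed \<open>v j\<close> sum to at least r,
  whereas tightness makes this sum r/n < r. For n = 1 and r \<ge> 2 all vectors are 1 or -1, so
  \<alpha> = 1 and the quotient in the robustness condition is d - 1.\<close>

lemma abs_\<alpha>_less_1: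
  assumes "CARD('n) \<ge> 2"
  shows "\<bar>\<alpha>\<bar> < 1"
proof (rule ccontr)
  assume "\<not> \<bar>\<alpha>\<bar> < 1"
  then have \<alpha>: "\<alpha>\<^sup>2 \<ge> 1" by (simp add: abs_square_less_1 not_less[symmetric])
  fix j :: 'r
  have "(v i \<bullet> v j)\<^sup>2 \<ge> 1" for i
    using \<alpha> inner_v_power[of 2 i j] by (cases "i = j") (simp_all add: inner_v_self)
  then have "real CARD('r) \<le> (\<Sum>i\<in>UNIV. (v i \<bullet> v j)\<^sup>2)"
    using sum_mono[of UNIV "\<lambda>_. 1 :: real" "\<lambda>i. (v i \<bullet> v j)\<^sup>2"] by simp
  also have "\<dots> = (\<Sum>i\<in>UNIV. (v i \<bullet> v j) *\<^sub>R v i) \<bullet> v j"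
    by (simp add: inner_sum_left power2_eq_square)
  also have "\<dots> = real CARD('r) / real CARD('n)"
    by (simp add: expansion inner_v_self \<rho>_def)
  also have "\<dots> < real CARD('r)"
    using assms by (simp add: divide_less_eq)
  finally show False by simp
qed

text \<open>Geometric decay of the powers of \<alpha> beats the linear factor d - 1, so the quotient
  tends to 0.\<close>

lemma eventually_condition:
  assumes "CARD('n) \<ge> 2"
  shows "\<forall>\<^sub>F d in sequentially.
    \<rho> * \<alpha> ^ (d - 2) * (real d - 1) / (1 + \<alpha> ^ (d - 2) * (\<rho> - 1)) < 1"
proof -
  have \<alpha>: "norm \<alpha> < 1" using abs_\<alpha>_less_1[OF assms] by simp
  have p: "(\<lambda>m. \<alpha> ^ m) \<longlonglongrightarrow> 0" using \<alpha> by (rule LIMSEQ_power_zero)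
  have np: "(\<lambda>m. real m * \<alpha> ^ m) \<longlonglongrightarrow> 0" using \<alpha> by (rule powser_times_n_limit_0)
  \<comment> \<open>Here m stands for d - 2, which turns d - 1 into m + 1 and avoids truncated
    subtraction.\<close>
  have "(\<lambda>m. \<rho> * (real m * \<alpha> ^ m + \<alpha> ^ m) / (1 + \<alpha> ^ m * (\<rho> - 1)))
      \<longlonglongrightarrow> \<rho> * (0 + 0) / (1 + 0 * (\<rho> - 1))"
    by (intro tendsto_intros p np) simp
  then have "\<forall>\<^sub>F m in sequentially. \<rho> * (real m * \<alpha> ^ m + \<alpha> ^ m) / (1 + \<alpha> ^ m * (\<rho> - 1)) < 1"
    by (rule order_tendstoD) simp
  then have "\<forall>\<^sub>F m in sequentially.
      \<rho> * \<alpha> ^ (m + 2 - 2) * (real (m + 2) - 1) / (1 + \<alpha> ^ (m + 2 - 2) * (\<rho> - 1)) < 1"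
    by eventually_elim (simp add: algebra_simps)
  then show ?thesis
    by (subst (asm) eventually_sequentially_seg)
qed

end

theorem theorem4p4:
  fixes v :: "'r::finite \<Rightarrow> real ^ 'n" and \<alpha> :: real
  assumes "equiangular_tight_frame v \<alpha>"
  shows
    "(\<exists>C::real. \<forall>j. (\<Sum>i\<in>UNIV - {j}. frame_sign v i j *\<^sub>R v i) = C *\<^sub>R v j) \<and>
     (\<forall>d::nat. even d \<and> d > 0 \<longrightarrow>
        (\<forall>j. eigenvector d (frame_tensor d v) (v j)) \<and>
        ((real CARD('r) / real CARD('n)) * \<alpha> ^ (d - 2) * (real d - 1)
           / (1 + \<alpha> ^ (d - 2) * (real CARD('r) / real CARD('n) - 1)) < 1 \<longrightarrow>
         (\<forall>j. robust_eigenvector d (frame_tensor d v) (v j)))) \<and>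
     (CARD('n) \<ge> 2 \<longrightarrow>
        (\<exists>D::nat. \<forall>d\<ge>D.
           (real CARD('r) / real CARD('n)) * \<alpha> ^ (d - 2) * (real d - 1)
             / (1 + \<alpha> ^ (d - 2) * (real CARD('r) / real CARD('n) - 1)) < 1))"
proof -
  interpret etf v \<alpha> "real CARD('r) / real CARD('n)"
    using assms by unfold_locales
  show ?thesis
    using signed_sum_proportional eigenvector_v robust_eigenvector_v
      eventually_condition[unfolded eventually_sequentially]
    by blast
qed

end
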